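(* Let $n\ge 3$ and $p>1$. Let $\psi\in C^2([0,+\infty))$ be positive on $(0,+\infty)$ with $\psi(0)=\psi''(0)=0$, $\psi'(0)=1$, $\psi'(r)\ge 0$ for every $r>0$, and $l:=\liminf_{r\to+\infty}\frac{\psi'(r)}{\psi(r)}>0$. Assume that one of the following alternatives holds: (a) $\limsup_{r\to+\infty}\frac{\psi'(r)}{\psi(r)}<+\infty$; (b) $l=+\infty$, $\left[\log\left(\frac{\psi'(r)}{\psi(r)}\right)\right]'=O(1)$ as $r\to+\infty$, and $\frac{\psi}{\psi'}\notin L^1(r_0,\infty)$, where $r_0\ge 0$ is any number such that $\psi'>0$ on $[r_0,+\infty)$. Then any radial solution of $-\Delta_g u=|u|^{p-1}u$ on $M$ is stable outside a compact set.
   Context: $(M,g)$ is the $n$-dimensional Riemannian model with pole $o$ and metric $ds^2=dr^2+\psi(r)^2d\Theta^2$ in polar coordinates $(r,\Theta)\in(0,\infty)\times\mathbb{S}^{n-1}$ around $o$ ($M$ is diffeomorphic to $\mathbb{R}^n$); $V_g$ and $\nabla_g$ are the Riemannian measure and gradient. A function is radial if it depends only on $r$, the distance from $o$; for radial $f$, $\Delta_g f=f''+(n-1)\frac{\psi'}{\psi}f'$. A solution $u\in C^2(M)$ of the equation is stable outside the compact set $K\subset M$ if $\int_{M\setminus K}|\nabla_g\varphi|_g^2\,dV_g-p\int_{M\setminus K}|u|^{p-1}\varphi^2\,dV_g\ge 0$ for all $\varphi\in C_c^\infty(M\setminus K)$; it is stable outside a compact set if this holds for some compact $K$. *)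

theory Defs
  imports "HOL-Analysis.Analysis" "HOL-Library.Landau_Symbols"
begin

text \<open>
  The model is realised on \<open>real ^ 'n\<close> with pole \<open>0\<close>, polar coordinates being \<open>r = norm x\<close> and
  \<open>\<Theta> = x / norm x\<close>; in these coordinates the distance from the pole is \<open>norm x\<close>, and the smooth
  structure and the topology are the standard ones.  A Riemannian metric is a function \<open>g\<close> such that
  \<open>g x\<close> is an inner product on the tangent space \<open>real ^ 'n\<close> at \<open>x\<close>.
\<close>

type_synonym 'n metric_tensor = "real ^ 'n \<Rightarrow> real ^ 'n \<Rightarrow> real ^ 'n \<Rightarrow> real"

text \<open>The differential of \<open>x \<mapsto> x / norm x\<close> at \<open>x \<noteq> 0\<close>.\<close>

definition dTheta :: "real ^ 'n \<Rightarrow> real ^ 'n \<Rightarrow> real ^ 'n" where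
  "dTheta x v = (v - (v \<bullet> sgn x) *\<^sub>R sgn x) /\<^sub>R norm x"

text \<open>
  The metric \<open>dr\<^sup>2 + \<psi>(r)\<^sup>2 d\<Theta>\<^sup>2\<close>.  At the pole it is extended by its limit, which is the Euclidean
  inner product when \<open>\<psi> 0 = 0\<close> and \<open>\<psi>' 0 = 1\<close>.
\<close>

definition model_metric :: "(real \<Rightarrow> real) \<Rightarrow> 'n::finite metric_tensor" where
  "model_metric \<psi> x v w =
     (if x = 0 then v \<bullet> w
      else (v \<bullet> sgn x) * (w \<bullet> sgn x) + (\<psi> (norm x))\<^sup>2 * (dTheta x v \<bullet> dTheta x w))"

definition riem_grad :: "'n::finite metric_tensor \<Rightarrow> (real ^ 'n \<Rightarrow> real) \<Rightarrow> real ^ 'n \<Rightarrow> real ^ 'n" where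
  "riem_grad g f x = (THE X. \<forall>v. g x X v = frechet_derivative f (at x) v)"

definition riem_density :: "'n::finite metric_tensor \<Rightarrow> real ^ 'n \<Rightarrow> real" where
  "riem_density g x = sqrt (det (\<chi> i j. g x (axis i 1) (axis j 1)))"

definition riem_vol :: "'n::finite metric_tensor \<Rightarrow> (real ^ 'n) measure" where
  "riem_vol g = density lborel (\<lambda>x. ennreal (riem_density g x))"

definition riem_div :: "'n::finite metric_tensor \<Rightarrow> (real ^ 'n \<Rightarrow> real ^ 'n) \<Rightarrow> real ^ 'n \<Rightarrow> real" where
  "riem_div g X x =
     (\<Sum>i\<in>UNIV. frechet_derivative (\<lambda>y. riem_density g y * X y $ i) (at x) (axis i 1))
       / riem_density g x"

text \<open>
  The Laplace-Beltrami operator.  For \<open>u\<close> of class \<open>C\<^sup>2\<close> every derivative below exists, also at the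
  pole: if \<open>\<psi>\<close> is \<open>C\<^sup>2\<close> with \<open>\<psi> 0 = \<psi>'' 0 = 0\<close> and \<open>\<psi>' 0 = 1\<close>, the model metric is \<open>C\<^sup>1\<close>.
\<close>

definition riem_laplacian :: "'n::finite metric_tensor \<Rightarrow> (real ^ 'n \<Rightarrow> real) \<Rightarrow> real ^ 'n \<Rightarrow> real" where
  "riem_laplacian g u = riem_div g (riem_grad g u)"

text \<open>\<open>C\<^sup>k\<close> on the whole space: all iterated directional derivatives up to order \<open>k\<close> are continuous.\<close>

primrec Ck :: "nat \<Rightarrow> (real ^ 'n::finite \<Rightarrow> real) \<Rightarrow> bool" where
  "Ck 0 f \<longleftrightarrow> continuous_on UNIV f"
| "Ck (Suc k) f \<longleftrightarrow> (\<forall>x. f differentiable (at x)) \<and> (\<forall>v. Ck k (\<lambda>x. frechet_derivative f (at x) v))"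

text \<open>
  \<open>C\<^sub>c\<^sup>\<infinity>(M - K)\<close>, each function being identified with its extension by zero to \<open>M\<close>.
\<close>

definition test_functions :: "(real ^ 'n::finite) set \<Rightarrow> (real ^ 'n \<Rightarrow> real) set" where
  "test_functions K =
     {\<phi>. (\<forall>k. Ck k \<phi>) \<and> compact (closure {x. \<phi> x \<noteq> 0}) \<and> closure {x. \<phi> x \<noteq> 0} \<subseteq> - K}"

definition radial :: "(real ^ 'n::finite \<Rightarrow> real) \<Rightarrow> bool" where
  "radial u \<longleftrightarrow> (\<exists>f. \<forall>x. u x = f (norm x))"

definition lane_emden_solution ::
    "'n::finite metric_tensor \<Rightarrow> real \<Rightarrow> (real ^ 'n \<Rightarrow> real) \<Rightarrow> bool" where
  "lane_emden_solution g p u \<longleftrightarrow>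
     Ck 2 u \<and> (\<forall>x. - riem_laplacian g u x = \<bar>u x\<bar> powr (p - 1) * u x)"

definition stable_outside ::
    "'n::finite metric_tensor \<Rightarrow> real \<Rightarrow> (real ^ 'n \<Rightarrow> real) \<Rightarrow> (real ^ 'n) set \<Rightarrow> bool" where
  "stable_outside g p u K \<longleftrightarrow>
     (\<forall>\<phi> \<in> test_functions K.
        (LINT x:- K|riem_vol g. g x (riem_grad g \<phi> x) (riem_grad g \<phi> x))
          - p * (LINT x:- K|riem_vol g. \<bar>u x\<bar> powr (p - 1) * (\<phi> x)\<^sup>2) \<ge> 0)"

definition stable_outside_compact ::
    "'n::finite metric_tensor \<Rightarrow> real \<Rightarrow> (real ^ 'n \<Rightarrow> real) \<Rightarrow> bool" where
  "stable_outside_compact g p u \<longleftrightarrow> (\<exists>K. compact K \<and> stable_outside g p u K)"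

end

theory Submission
  imports Defs
begin

text \<open>
  Write \<open>h = \<psi>' / \<psi>\<close>, so that \<open>(n - 1) h(r)\<close> is the mean curvature of the geodesic sphere of radius \<open>r\<close>
  and the Laplacian of the distance from the pole.  Where it is at least \<open>c > 0\<close>, integrating the
  divergence of \<open>\<phi>\<^sup>2 \<partial>\<^sub>r\<close> and completing a square gives the Hardy inequality
  \<open>\<integral> \<bar>\<nabla>\<phi>\<bar>\<^sup>2 \<ge> (c\<^sup>2 / 4) \<integral> \<phi>\<^sup>2\<close>.  Hence \<open>u\<close> is stable outside a ball as soon as
  \<open>p \<bar>u\<bar>\<^sup>p\<^sup>-\<^sup>1 \<le> c\<^sup>2 / 4\<close> holds beyond it (\<open>stable_outside_cball\<close>), and the question becomes how large
  \<open>u\<close> is far from the pole.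

  A radial solution \<open>u = f(r)\<close> satisfies \<open>f'' + (n - 1) h f' + \<bar>f\<bar>\<^sup>p\<^sup>-\<^sup>1 f = 0\<close>
  (\<open>riem_laplacian_radial\<close>), the motion of a particle with friction in a potential well.  Its energy
  decreases (\<open>energy_decreasing\<close>), so \<open>f\<close> is bounded.

  If \<open>l = \<infinity>\<close>, the constant \<open>c\<close> may be taken as large as desired far from the pole, and
  boundedness of \<open>f\<close> is enough.  If \<open>h\<close> lies eventually between two positive constants, \<open>c\<close> is fixed,
  but the friction, neither degenerate nor unbounded, forces the energy and thus \<open>f\<close> to tend to zero
  (\<open>damped_solution_vanishes\<close>), so that the potential falls below \<open>c\<^sup>2 / 4\<close>.
\<close>

section \<open>Damped motion in a power potential\<close>

text \<open>
  The point \<open>t = 0\<close> is included: there the difference quotient has modulus \<open>\<bar>h\<bar> powr p / (p + 1)\<close>.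
\<close>

lemma has_real_derivative_abs_powr:
  fixes p t :: real
  assumes "p > 1"
  shows "((\<lambda>t. \<bar>t\<bar> powr (p + 1) / (p + 1)) has_real_derivative \<bar>t\<bar> powr (p - 1) * t) (at t)"
proof -
  consider "t > 0" | "t < 0" | "t = 0" by linarith
  then show ?thesis
  proof cases
    case 1
    have "((\<lambda>t. t powr (p + 1) / (p + 1)) has_real_derivative t powr p) (at t)"
      using 1 assms by (auto intro!: derivative_eq_intros)
    then have "((\<lambda>t. \<bar>t\<bar> powr (p + 1) / (p + 1)) has_real_derivative t powr p) (at t)"
      by (rule has_field_derivative_transform_within_open[where S = "{0<..}"]) (use 1 in auto)
    then show ?thesis using 1 by (simp add: powr_diff)
  next
    case 2
    have "((\<lambda>t. (- t) powr (p + 1) / (p + 1)) has_real_derivative - ((- t) powr p)) (at t)"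
      using 2 assms by (auto intro!: derivative_eq_intros)
    then have "((\<lambda>t. \<bar>t\<bar> powr (p + 1) / (p + 1)) has_real_derivative - ((- t) powr p)) (at t)"
      by (rule has_field_derivative_transform_within_open[where S = "{..<0}"]) (use 2 in auto)
    then show ?thesis using 2 by (simp add: powr_diff)
  next
    case 3
    have "((\<lambda>h::real. \<bar>h\<bar> powr p / (p + 1)) \<longlongrightarrow> 0) (at 0)"
      using assms by (intro tendsto_eq_intros | auto)+
    then have "((\<lambda>h::real. (\<bar>0 + h\<bar> powr (p + 1) / (p + 1) - \<bar>0\<bar> powr (p + 1) / (p + 1)) / h) \<longlongrightarrow> 0) (at 0)"
    proof (rule tendsto_rabs_zero_cancel[OF Lim_transform_eventually[OF tendsto_rabs_zero]])
      show "\<forall>\<^sub>F h in at 0. \<bar>\<bar>h\<bar> powr p / (p + 1)\<bar> =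
        \<bar>(\<bar>0 + h\<bar> powr (p + 1) / (p + 1) - \<bar>0\<bar> powr (p + 1) / (p + 1)) / h\<bar>"
        using assms by (auto simp: eventually_at_filter powr_add abs_mult)
    qed
    then show ?thesis
      using 3 by (simp add: DERIV_def)
  qed
qed

text \<open>
  The mechanical energy of a particle at position \<open>f\<close> with velocity \<open>f1\<close> in the potential well
  \<open>\<bar>t\<bar> powr (p + 1) / (p + 1)\<close>.  A radial solution of the Lane-Emden equation is such a particle with
  friction coefficient \<open>a r = (n - 1) \<psi>'(r) / \<psi>(r)\<close>.
\<close>

definition energy :: "real \<Rightarrow> (real \<Rightarrow> real) \<Rightarrow> (real \<Rightarrow> real) \<Rightarrow> real \<Rightarrow> real" where
  "energy p f f1 r = (f1 r)\<^sup>2 / 2 + \<bar>f r\<bar> powr (p + 1) / (p + 1)"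

lemma energy_has_derivative:
  assumes "p > 1"
    and "(f has_real_derivative f1 r) (at r)"
    and "(f1 has_real_derivative - a * f1 r - \<bar>f r\<bar> powr (p - 1) * f r) (at r)"
  shows "(energy p f f1 has_real_derivative - a * (f1 r)\<^sup>2) (at r)"
proof -
  have "((\<lambda>r. \<bar>f r\<bar> powr (p + 1) / (p + 1)) has_real_derivative
      \<bar>f r\<bar> powr (p - 1) * f r * f1 r) (at r)"
    using DERIV_chain2[OF has_real_derivative_abs_powr[OF assms(1)] assms(2)] .
  from DERIV_add[OF DERIV_cdivide[OF DERIV_power[OF assms(3), of 2], of 2] this]
  show ?thesis
    unfolding energy_def by (rule DERIV_cong) (simp add: field_simps power2_eq_square)
qed

lemma energy_decreasing:
  assumes "p > 1"
    and "\<And>r. r > 0 \<Longrightarrow> (f has_real_derivative f1 r) (at r)"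
    and "\<And>r. r > 0 \<Longrightarrow> (f1 has_real_derivative - a r * f1 r - \<bar>f r\<bar> powr (p - 1) * f r) (at r)"
    and "\<And>r. r > 0 \<Longrightarrow> a r \<ge> 0"
    and "0 < r" "r \<le> s"
  shows "energy p f f1 s \<le> energy p f f1 r"
proof (rule DERIV_nonpos_imp_nonincreasing[OF \<open>r \<le> s\<close>])
  fix x assume "r \<le> x" "x \<le> s"
  then have "x > 0" using \<open>0 < r\<close> by simp
  show "\<exists>y. (energy p f f1 has_real_derivative y) (at x) \<and> y \<le> 0"
    using energy_has_derivative[OF assms(1) assms(2,3)[OF \<open>x > 0\<close>]] assms(4)[OF \<open>x > 0\<close>]
    by (intro exI[of _ "- a x * (f1 x)\<^sup>2"]) (auto intro: mult_nonneg_nonneg)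
qed

lemma
  assumes "p > 1" "energy p f f1 r \<le> e"
  shows abs_le_of_energy_le: "\<bar>f r\<bar> \<le> ((p + 1) * e) powr (1 / (p + 1))"
    and deriv_le_of_energy_le: "\<bar>f1 r\<bar> \<le> sqrt (2 * e)"
proof -
  have "\<bar>f r\<bar> powr (p + 1) / (p + 1) \<le> e"
    using assms(2) zero_le_power2[of "f1 r"] unfolding energy_def by linarith
  then have "\<bar>f r\<bar> powr (p + 1) \<le> (p + 1) * e"
    using assms(1) by (simp add: field_simps)
  then have "(\<bar>f r\<bar> powr (p + 1)) powr (1 / (p + 1)) \<le> ((p + 1) * e) powr (1 / (p + 1))"
    using assms(1) by (intro powr_mono2) auto
  then show "\<bar>f r\<bar> \<le> ((p + 1) * e) powr (1 / (p + 1))"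
    using assms(1) by (simp add: powr_powr)
  have "\<bar>f r\<bar> powr (p + 1) / (p + 1) \<ge> 0" using assms(1) by simp
  then have "(f1 r)\<^sup>2 \<le> 2 * e" using assms(2) unfolding energy_def by linarith
  then show "\<bar>f1 r\<bar> \<le> sqrt (2 * e)" by (rule real_le_rsqrt[of "\<bar>f1 r\<bar>", simplified])
qed

text \<open>
  If the energy stayed above a positive level \<open>e\<close>, the corrected energy \<open>G = energy + \<epsilon> f f1\<close> would
  decrease at a definite rate, which is absurd because it is bounded below.  The correction is needed
  because friction dissipates only kinetic energy: its derivative contributes \<open>- \<epsilon> \<bar>f\<bar>\<^sup>p\<^sup>+\<^sup>1\<close> when the
  particle is far from the origin, whereas near it at least half of \<open>e\<close> is kinetic energy and friction
  itself acts.  The bounds on \<open>a\<close> from both sides control the cross term \<open>\<epsilon> a f f1\<close>.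
\<close>

lemma damped_solution_vanishes:
  assumes "p > 1"
    and f: "\<And>r. r > 0 \<Longrightarrow> (f has_real_derivative f1 r) (at r)"
    and f1: "\<And>r. r > 0 \<Longrightarrow> (f1 has_real_derivative - a r * f1 r - \<bar>f r\<bar> powr (p - 1) * f r) (at r)"
    and a0: "\<And>r. r > 0 \<Longrightarrow> a r \<ge> 0"
    and a: "\<And>r. r \<ge> R \<Longrightarrow> c \<le> a r" "\<And>r. r \<ge> R \<Longrightarrow> a r \<le> C"
    and "c > 0" "R > 0" "\<eta> > 0"
  shows "\<exists>S \<ge> R. \<forall>r \<ge> S. \<bar>f r\<bar> \<le> \<eta>"
proof -
  define e where "e = \<eta> powr (p + 1) / (p + 1)"
  have "e > 0" using assms by (simp add: e_def)
  have decr: "energy p f f1 s \<le> energy p f f1 r" if "0 < r" "r \<le> s" for r s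
    using energy_decreasing[OF assms(1) f f1 a0 that] .
  have "\<exists>S \<ge> R. energy p f f1 S \<le> e"
  proof (rule ccontr)
    assume "\<not> ?thesis"
    then have big: "energy p f f1 r > e" if "r \<ge> R" for r using that by force
    have "C > 0" using a[of R] \<open>c > 0\<close> by simp
    \<comment> \<open>The threshold between far and near: at distance at most \<open>k\<close> the potential energy is at most \<open>e / 2\<close>.\<close>
    define k where "k = \<eta> / 2"
    define \<kappa> where "\<kappa> = k powr (p - 1)"
    have "k > 0" "\<kappa> > 0" using \<open>\<eta> > 0\<close> by (auto simp: k_def \<kappa>_def)
    \<comment> \<open>The three bounds let friction absorb \<open>\<epsilon> f1\<^sup>2\<close>, let the potential term absorb the cross term for
      \<open>\<bar>f\<bar> \<ge> k\<close>, and let the kinetic energy do so for \<open>\<bar>f\<bar> < k\<close>.\<close>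
    define \<epsilon> where "\<epsilon> = min (c / 4) (min (c * \<kappa> / (2 * C\<^sup>2)) (c * e / (2 * \<kappa> * k\<^sup>2)))"
    have "\<epsilon> > 0"
      using \<open>c > 0\<close> \<open>C > 0\<close> \<open>k > 0\<close> \<open>\<kappa> > 0\<close> \<open>e > 0\<close> by (simp add: \<epsilon>_def)
    have \<epsilon>1: "\<epsilon> \<le> c / 4" by (simp add: \<epsilon>_def)
    have "\<epsilon> \<le> c * \<kappa> / (2 * C\<^sup>2)" by (simp add: \<epsilon>_def)
    then have \<epsilon>2: "\<epsilon> * C\<^sup>2 / c \<le> \<kappa> / 2"
      using \<open>c > 0\<close> \<open>C > 0\<close> by (simp add: field_simps)
    have "\<epsilon> \<le> c * e / (2 * \<kappa> * k\<^sup>2)" by (simp add: \<epsilon>_def)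
    then have \<epsilon>3: "\<epsilon> * \<kappa> * k\<^sup>2 / 2 \<le> c * e / 4"
      using \<open>\<kappa> > 0\<close> \<open>k > 0\<close> by (simp add: field_simps)
    define \<delta> where "\<delta> = \<epsilon> * \<kappa> * k\<^sup>2 / 2"
    have "\<delta> > 0" using \<open>\<epsilon> > 0\<close> \<open>\<kappa> > 0\<close> \<open>k > 0\<close> by (simp add: \<delta>_def)
    define G where "G r = energy p f f1 r + \<epsilon> * (f r * f1 r)" for r
    have G': "(G has_real_derivative
        - a r * (f1 r)\<^sup>2 + \<epsilon> * ((f1 r)\<^sup>2 - a r * (f r * f1 r) - \<bar>f r\<bar> powr (p - 1) * (f r)\<^sup>2)) (at r)"
      if "r > 0" for r
      unfolding G_def
      by (rule derivative_eq_intros energy_has_derivative[OF assms(1) f[OF that] f1[OF that]] f[OF that] f1[OF that] refl)+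
         (simp add: algebra_simps power2_eq_square)
    have G'_le: "- a r * (f1 r)\<^sup>2 + \<epsilon> * ((f1 r)\<^sup>2 - a r * (f r * f1 r) - \<bar>f r\<bar> powr (p - 1) * (f r)\<^sup>2) \<le> - \<delta>"
      if "r \<ge> R" for r
    proof -
      have "c \<le> a r" "a r \<le> C" using a that by auto
      have "- a r * (f r * f1 r) \<le> a r * \<bar>f r * f1 r\<bar>"
        using \<open>c \<le> a r\<close> \<open>c > 0\<close> abs_ge_minus_self[of "a r * (f r * f1 r)"] by (simp add: abs_mult)
      also have "\<dots> \<le> C * (\<bar>f r\<bar> * \<bar>f1 r\<bar>)"
        using \<open>a r \<le> C\<close> by (simp add: abs_mult mult_right_mono)
      finally have "\<epsilon> * (- a r * (f r * f1 r)) \<le> \<epsilon> * (C * (\<bar>f r\<bar> * \<bar>f1 r\<bar>))"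
        using \<open>\<epsilon> > 0\<close> by (intro mult_left_mono) auto
      also have "\<dots> \<le> c / 4 * (f1 r)\<^sup>2 + \<epsilon>\<^sup>2 * C\<^sup>2 / c * (f r)\<^sup>2"
      proof -
        have "0 \<le> (c * \<bar>f1 r\<bar> / 2 - \<epsilon> * C * \<bar>f r\<bar>)\<^sup>2 / c" using \<open>c > 0\<close> by simp
        also have "\<dots> = c / 4 * (f1 r)\<^sup>2 + \<epsilon>\<^sup>2 * C\<^sup>2 / c * (f r)\<^sup>2 - \<epsilon> * (C * (\<bar>f r\<bar> * \<bar>f1 r\<bar>))"
          using \<open>c > 0\<close> by (simp add: power2_diff field_simps power_mult_distrib) (simp add: power2_eq_square)
        finally show ?thesis by simp
      qed
      finally have cross: "\<epsilon> * (- a r * (f r * f1 r)) \<le> c / 4 * (f1 r)\<^sup>2 + \<epsilon>\<^sup>2 * C\<^sup>2 / c * (f r)\<^sup>2" .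
      have "(\<epsilon> - a r) * (f1 r)\<^sup>2 \<le> - (3 * c / 4) * (f1 r)\<^sup>2"
        using \<open>c \<le> a r\<close> \<epsilon>1 by (intro mult_right_mono) auto
      with cross have main: "- a r * (f1 r)\<^sup>2 + \<epsilon> * ((f1 r)\<^sup>2 - a r * (f r * f1 r) - \<bar>f r\<bar> powr (p - 1) * (f r)\<^sup>2)
          \<le> - c / 2 * (f1 r)\<^sup>2 + \<epsilon>\<^sup>2 * C\<^sup>2 / c * (f r)\<^sup>2 - \<epsilon> * (\<bar>f r\<bar> powr (p - 1) * (f r)\<^sup>2)"
        by (simp add: algebra_simps)
      have "\<epsilon> * (\<epsilon> * C\<^sup>2 / c) * (f r)\<^sup>2 \<le> \<epsilon> * (\<kappa> / 2) * (f r)\<^sup>2"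
        using \<epsilon>2 \<open>\<epsilon> > 0\<close> by (intro mult_right_mono mult_left_mono) auto
      then have sq: "\<epsilon>\<^sup>2 * C\<^sup>2 / c * (f r)\<^sup>2 \<le> \<epsilon> * \<kappa> / 2 * (f r)\<^sup>2"
        by (simp add: power2_eq_square mult_ac)
      show ?thesis
      proof (cases "\<bar>f r\<bar> \<ge> k")
        case True
        have "\<kappa> \<le> \<bar>f r\<bar> powr (p - 1)"
          unfolding \<kappa>_def using True \<open>k > 0\<close> \<open>p > 1\<close> by (intro powr_mono2) auto
        then have 1: "\<epsilon> * (\<kappa> * (f r)\<^sup>2) \<le> \<epsilon> * (\<bar>f r\<bar> powr (p - 1) * (f r)\<^sup>2)"
          using \<open>\<epsilon> > 0\<close> by (intro mult_left_mono mult_right_mono) auto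
        have "k\<^sup>2 \<le> (f r)\<^sup>2" using True \<open>k > 0\<close> by (simp add: abs_le_square_iff[symmetric])
        then have "\<delta> \<le> \<epsilon> * \<kappa> / 2 * (f r)\<^sup>2"
          unfolding \<delta>_def using \<open>\<epsilon> > 0\<close> \<open>\<kappa> > 0\<close> by simp
        moreover have "c / 2 * (f1 r)\<^sup>2 \<ge> 0" using \<open>c > 0\<close> by simp
        moreover have "- c / 2 * (f1 r)\<^sup>2 = - (c / 2 * (f1 r)\<^sup>2)" by simp
        moreover have "\<epsilon> * (\<kappa> * (f r)\<^sup>2) = 2 * (\<epsilon> * \<kappa> / 2 * (f r)\<^sup>2)" by simp
        ultimately show ?thesis
          using main 1 sq by linarith
      next
        case False
        have "\<bar>f r\<bar> powr (p + 1) \<le> k powr (p + 1)"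
          using False \<open>p > 1\<close> by (intro powr_mono2) auto
        also have "\<dots> = \<eta> powr (p + 1) / 2 powr (p + 1)"
          using \<open>\<eta> > 0\<close> by (simp add: k_def powr_divide)
        also have "\<dots> \<le> \<eta> powr (p + 1) / 2 powr 1"
          using \<open>p > 1\<close> by (intro divide_left_mono powr_mono) auto
        finally have "\<bar>f r\<bar> powr (p + 1) / (p + 1) \<le> \<eta> powr (p + 1) / 2 powr 1 / (p + 1)"
          using \<open>p > 1\<close> by (intro divide_right_mono) auto
        then have "\<bar>f r\<bar> powr (p + 1) / (p + 1) \<le> e / 2"
          using \<open>p > 1\<close> by (simp add: e_def field_simps)
        then have "e \<le> (f1 r)\<^sup>2"
          using big[OF that] unfolding energy_def by linarith
        then have 1: "c / 2 * e \<le> c / 2 * (f1 r)\<^sup>2"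
          using \<open>c > 0\<close> by simp
        have "(f r)\<^sup>2 \<le> k\<^sup>2" using False \<open>k > 0\<close> by (simp add: abs_le_square_iff[symmetric])
        then have "\<epsilon> * \<kappa> / 2 * (f r)\<^sup>2 \<le> \<delta>"
          unfolding \<delta>_def using \<open>\<epsilon> > 0\<close> \<open>\<kappa> > 0\<close> by simp
        moreover have "\<epsilon> * (\<bar>f r\<bar> powr (p - 1) * (f r)\<^sup>2) \<ge> 0" using \<open>\<epsilon> > 0\<close> by simp
        moreover have "\<delta> \<le> c * e / 4" using \<epsilon>3 by (simp add: \<delta>_def)
        moreover have "- c / 2 * (f1 r)\<^sup>2 = - (c / 2 * (f1 r)\<^sup>2)" by simp
        moreover have "c / 2 * e = 2 * (c * e / 4)" by simp
        ultimately show ?thesis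
          using main 1 sq by linarith
      qed
    qed
    define B where "B = ((p + 1) * energy p f f1 R) powr (1 / (p + 1))"
    define B1 where "B1 = sqrt (2 * energy p f f1 R)"
    have G_ge: "G r \<ge> - (\<epsilon> * (B * B1))" if "r \<ge> R" for r
    proof -
      have "energy p f f1 r \<le> energy p f f1 R" using decr that \<open>R > 0\<close> by simp
      then have "\<bar>f r\<bar> \<le> B" "\<bar>f1 r\<bar> \<le> B1"
        unfolding B_def B1_def using abs_le_of_energy_le deriv_le_of_energy_le \<open>p > 1\<close> by blast+
      then have "\<bar>f r\<bar> * \<bar>f1 r\<bar> \<le> B * B1" by (intro mult_mono) auto
      then have "- (B * B1) \<le> f r * f1 r" by (simp add: abs_mult[symmetric] abs_le_iff)
      then have "\<epsilon> * (- (B * B1)) \<le> \<epsilon> * (f r * f1 r)"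
        using \<open>\<epsilon> > 0\<close> by (intro mult_left_mono) auto
      moreover have "energy p f f1 r \<ge> 0"
        using \<open>p > 1\<close> by (simp add: energy_def)
      ultimately show ?thesis by (simp add: G_def)
    qed
    have lin: "G r + \<delta> * r \<le> G R + \<delta> * R" if "r \<ge> R" for r
    proof (rule DERIV_nonpos_imp_nonincreasing[OF that])
      fix x assume "R \<le> x" "x \<le> r"
      then have "x > 0" using \<open>R > 0\<close> by simp
      show "\<exists>y. ((\<lambda>r. G r + \<delta> * r) has_real_derivative y) (at x) \<and> y \<le> 0"
        using G'_le[OF \<open>R \<le> x\<close>]
        by (intro exI conjI) (rule derivative_eq_intros G'[OF \<open>x > 0\<close>] refl | simp)+
    qed
    define r where "r = R + (G R + \<epsilon> * (B * B1)) / \<delta> + 1"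
    have "r \<ge> R" using G_ge[of R] \<open>\<delta> > 0\<close> by (simp add: r_def)
    have "\<delta> * r = \<delta> * R + (G R + \<epsilon> * (B * B1)) + \<delta>"
      using \<open>\<delta> > 0\<close> by (simp add: r_def field_simps)
    then show False
      using lin[OF \<open>r \<ge> R\<close>] G_ge[OF \<open>r \<ge> R\<close>] \<open>\<delta> > 0\<close> by linarith
  qed
  then obtain S where S: "S \<ge> R" "energy p f f1 S \<le> e" by blast
  have "\<bar>f r\<bar> \<le> \<eta>" if "r \<ge> S" for r
  proof -
    have "energy p f f1 r \<le> e" using decr[of S r] S that \<open>R > 0\<close> by simp
    from abs_le_of_energy_le[OF \<open>p > 1\<close> this] show ?thesis
      using \<open>\<eta> > 0\<close> \<open>p > 1\<close> by (simp add: e_def powr_powr)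
  qed
  then show ?thesis using S(1) by blast
qed

section \<open>Density and gradient of the model metric\<close>

lemma model_metric_off_pole:
  fixes x :: "real ^ 'n::finite"
  assumes "x \<noteq> 0"
  shows "model_metric \<psi> x v w =
    (v \<bullet> sgn x) * (w \<bullet> sgn x) + (\<psi> (norm x) / norm x)\<^sup>2 * (v \<bullet> w - (v \<bullet> sgn x) * (w \<bullet> sgn x))"
proof -
  have "sgn x \<bullet> sgn x = 1"
    using assms by (simp add: dot_square_norm norm_sgn)
  then have "(v - (v \<bullet> sgn x) *\<^sub>R sgn x) \<bullet> (w - (w \<bullet> sgn x) *\<^sub>R sgn x) = v \<bullet> w - (v \<bullet> sgn x) * (w \<bullet> sgn x)"
    by (simp add: inner_diff_left inner_diff_right inner_commute[of "sgn x" w])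
  then have "dTheta x v \<bullet> dTheta x w = (v \<bullet> w - (v \<bullet> sgn x) * (w \<bullet> sgn x)) / (norm x)\<^sup>2"
    by (simp add: dTheta_def power2_eq_square divide_inverse mult_ac)
  then show ?thesis using assms by (simp add: model_metric_def power_divide)
qed

text \<open>
  A rotation taking \<open>s\<close> to a coordinate axis diagonalises the matrix, with eigenvalue \<open>1\<close> along \<open>s\<close> and
  eigenvalue \<open>a\<close> on its orthogonal complement.
\<close>

lemma det_rank_one_perturbation:
  fixes s :: "real ^ 'n::finite"
  assumes "norm s = 1"
  shows "det (\<chi> i j. a * (if i = j then 1 else 0) + (1 - a) * (s $ i * s $ j)) = a ^ (CARD('n) - 1)"
proof -
  obtain k :: 'n where True by simp
  have "norm (axis k 1 :: real ^ 'n) = 1" by simp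
  then obtain T :: "real ^ 'n \<Rightarrow> real ^ 'n" where T: "orthogonal_transformation T" "T (axis k 1) = s"
    using assms by (metis orthogonal_transformation_exists_1)
  define A where "A = matrix T"
  have ortho: "orthogonal_matrix A"
    using T(1) by (simp add: A_def orthogonal_transformation_matrix)
  have col: "A $ i $ k = s $ i" for i
    using T(2) by (simp add: A_def matrix_def)
  have rows: "(\<Sum>l\<in>UNIV. A $ i $ l * A $ j $ l) = (if i = j then 1 else 0)" for i j
  proof -
    have "(A ** transpose A) $ i $ j = (mat 1 :: real ^ 'n ^ 'n) $ i $ j"
      using ortho by (simp add: orthogonal_matrix_def)
    then show ?thesis by (simp add: matrix_matrix_mult_def transpose_def mat_def)
  qed
  define d where "d l = (if l = k then 1 else a)" for l
  define D :: "real ^ 'n ^ 'n" where "D = (\<chi> i j. if i = j then d i else 0)"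
  have "(A ** D ** transpose A) $ i $ j = a * (if i = j then 1 else 0) + (1 - a) * (s $ i * s $ j)" for i j
  proof -
    have "(A ** D) $ i $ l = A $ i $ l * d l" for l
    proof -
      have "(A ** D) $ i $ l = (\<Sum>m\<in>UNIV. A $ i $ m * (if m = l then d m else 0))"
        by (simp add: matrix_matrix_mult_def D_def)
      also have "\<dots> = (\<Sum>m\<in>UNIV. if m = l then A $ i $ l * d l else 0)"
        by (rule sum.cong) auto
      finally show ?thesis by simp
    qed
    then have "(A ** D ** transpose A) $ i $ j = (\<Sum>l\<in>UNIV. A $ i $ l * d l * A $ j $ l)"
      by (simp add: matrix_matrix_mult_def[of "A ** D"] transpose_def)
    also have "\<dots> = (\<Sum>l\<in>UNIV. a * (A $ i $ l * A $ j $ l) + (if l = k then (1 - a) * (A $ i $ k * A $ j $ k) else 0))"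
      by (rule sum.cong) (auto simp: d_def algebra_simps)
    also have "\<dots> = a * (if i = j then 1 else 0) + (1 - a) * (s $ i * s $ j)"
      unfolding sum.distrib sum_distrib_left[symmetric] rows by (simp add: col)
    finally show ?thesis .
  qed
  then have "(\<chi> i j. a * (if i = j then 1 else 0) + (1 - a) * (s $ i * s $ j)) = A ** D ** transpose A"
    by (simp add: vec_eq_iff)
  moreover have "det A * det A = 1"
    using det_orthogonal_matrix[OF ortho] by auto
  moreover have "det D = a ^ (CARD('n) - 1)"
  proof -
    have "det D = (\<Prod>i\<in>UNIV. d i)"
      using det_diagonal[of D] by (simp add: D_def)
    also have "\<dots> = (\<Prod>i\<in>UNIV - {k}. a)"
      by (subst prod.remove[of UNIV k]) (auto simp: d_def intro!: prod.cong)
    finally show ?thesis by simp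
  qed
  ultimately show ?thesis by (simp add: det_mul)
qed

text \<open>
  In Cartesian coordinates the metric matrix has eigenvalue \<open>1\<close> in the radial direction and
  \<open>(\<psi>(r) / r)\<^sup>2\<close> in the \<open>n - 1\<close> tangential ones.
\<close>

lemma riem_density_model:
  fixes x :: "real ^ 'n::finite"
  assumes "x \<noteq> 0" and "\<psi> (norm x) > 0"
  shows "riem_density (model_metric \<psi>) x = (\<psi> (norm x) / norm x) ^ (CARD('n) - 1)"
proof -
  let ?a = "(\<psi> (norm x) / norm x)\<^sup>2"
  have "(\<chi> i j. model_metric \<psi> x (axis i 1) (axis j 1)) =
      (\<chi> i j. ?a * (if i = j then 1 else 0) + (1 - ?a) * (sgn x $ i * sgn x $ j))"
    using assms(1) by (simp add: model_metric_off_pole vec_eq_iff inner_axis' inner_axis inner_axis_axis algebra_simps)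
       (simp add: axis_def)
  then have "det (\<chi> i j. model_metric \<psi> x (axis i 1) (axis j 1)) = ?a ^ (CARD('n) - 1)"
    using det_rank_one_perturbation[of "sgn x" ?a] assms(1) by (simp add: norm_sgn)
  also have "\<dots> = ((\<psi> (norm x) / norm x) ^ (CARD('n) - 1))\<^sup>2"
    by (simp add: power_mult[symmetric] mult.commute)
  finally show ?thesis
    using assms(2) by (simp add: riem_density_def)
qed

lemma riem_density_pole: "riem_density (model_metric \<psi>) (0 :: real ^ 'n::finite) = 1"
proof -
  have "(\<chi> i j. model_metric \<psi> (0 :: real ^ 'n) (axis i 1) (axis j 1)) = mat 1"
    by (simp add: model_metric_def vec_eq_iff mat_def inner_axis_axis)
  then show ?thesis by (simp add: riem_density_def)
qed

text \<open>
  The radial part of the Euclidean gradient \<open>d\<close> is kept and its tangential part is divided by the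
  eigenvalue \<open>(\<psi>(r) / r)\<^sup>2\<close>; positive definiteness gives uniqueness.
\<close>

lemma riem_grad_model:
  fixes x :: "real ^ 'n::finite"
  assumes "x \<noteq> 0" and "\<psi> (norm x) > 0" and "(f has_derivative (\<lambda>v. d \<bullet> v)) (at x)"
  shows "riem_grad (model_metric \<psi>) f x =
    (d \<bullet> sgn x) *\<^sub>R sgn x + (norm x / \<psi> (norm x))\<^sup>2 *\<^sub>R (d - (d \<bullet> sgn x) *\<^sub>R sgn x)"
proof -
  let ?s = "sgn x"
  define a b where "a = (\<psi> (norm x) / norm x)\<^sup>2" and "b = (norm x / \<psi> (norm x))\<^sup>2"
  define X where "X = (d \<bullet> ?s) *\<^sub>R ?s + b *\<^sub>R (d - (d \<bullet> ?s) *\<^sub>R ?s)"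
  have ss: "?s \<bullet> ?s = 1" using assms by (simp add: dot_square_norm norm_sgn)
  have inv: "a * b = 1" using assms by (simp add: a_def b_def field_simps)
  have "a > 0" using assms by (simp add: a_def)
  have metric: "model_metric \<psi> x v w = (v \<bullet> ?s) * (w \<bullet> ?s) + a * (v \<bullet> w - (v \<bullet> ?s) * (w \<bullet> ?s))" for v w
    using model_metric_off_pole[OF assms(1)] by (simp add: a_def)
  have D: "frechet_derivative f (at x) = (\<lambda>v. d \<bullet> v)"
    using frechet_derivative_at[OF assms(3)] by simp
  have sol: "model_metric \<psi> x X v = d \<bullet> v" for v
  proof -
    have Xs: "X \<bullet> ?s = d \<bullet> ?s"
      by (simp add: X_def inner_add_left inner_diff_left ss)
    have "X \<bullet> v - (d \<bullet> ?s) * (v \<bullet> ?s) = b * (d \<bullet> v - (d \<bullet> ?s) * (v \<bullet> ?s))"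
      by (simp add: X_def inner_add_left inner_diff_left inner_commute[of ?s v])
    then have "a * (X \<bullet> v - (d \<bullet> ?s) * (v \<bullet> ?s)) = (a * b) * (d \<bullet> v - (d \<bullet> ?s) * (v \<bullet> ?s))"
      by simp
    then show ?thesis
      unfolding metric Xs inv by simp
  qed
  have "riem_grad (model_metric \<psi>) f x = X"
    unfolding riem_grad_def D
  proof (rule the_equality)
    show "\<forall>v. model_metric \<psi> x X v = d \<bullet> v" using sol by blast
  next
    fix Y assume Y: "\<forall>v. model_metric \<psi> x Y v = d \<bullet> v"
    define Z where "Z = Y - X"
    have "model_metric \<psi> x Z v = model_metric \<psi> x Y v - model_metric \<psi> x X v" for v
      unfolding metric Z_def inner_diff_left by (simp add: algebra_simps)
    then have "model_metric \<psi> x Z Z = 0" using Y sol by simp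
    then have "(Z \<bullet> ?s)\<^sup>2 + a * (Z \<bullet> Z - (Z \<bullet> ?s)\<^sup>2) = 0"
      by (simp add: metric power2_eq_square)
    moreover have "(Z \<bullet> ?s)\<^sup>2 \<le> Z \<bullet> Z"
      using Cauchy_Schwarz_ineq[of Z ?s] ss by simp
    then have "0 \<le> a * (Z \<bullet> Z - (Z \<bullet> ?s)\<^sup>2)"
      using \<open>a > 0\<close> by simp
    ultimately have "(Z \<bullet> ?s)\<^sup>2 = 0" "a * (Z \<bullet> Z - (Z \<bullet> ?s)\<^sup>2) = 0"
      using zero_le_power2[of "Z \<bullet> ?s"] by linarith+
    then show "Y = X" using \<open>a > 0\<close> by (simp add: Z_def)
  qed
  then show ?thesis by (simp add: X_def b_def)
qed

lemma norm_riem_grad_model: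
  fixes x :: "real ^ 'n::finite"
  assumes "x \<noteq> 0" and "\<psi> (norm x) > 0" and "(f has_derivative (\<lambda>v. d \<bullet> v)) (at x)"
  shows "model_metric \<psi> x (riem_grad (model_metric \<psi>) f x) (riem_grad (model_metric \<psi>) f x) =
    (d \<bullet> sgn x)\<^sup>2 + (norm x / \<psi> (norm x))\<^sup>2 * (d \<bullet> d - (d \<bullet> sgn x)\<^sup>2)"
proof -
  define a b where "a = (\<psi> (norm x) / norm x)\<^sup>2" and "b = (norm x / \<psi> (norm x))\<^sup>2"
  define X where "X = (d \<bullet> sgn x) *\<^sub>R sgn x + b *\<^sub>R (d - (d \<bullet> sgn x) *\<^sub>R sgn x)"
  define t where "t = d \<bullet> sgn x"
  have ss: "sgn x \<bullet> sgn x = 1" using assms by (simp add: dot_square_norm norm_sgn)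
  have inv: "a * b = 1" using assms by (simp add: a_def b_def field_simps)
  have grad: "riem_grad (model_metric \<psi>) f x = X"
    unfolding X_def b_def by (rule riem_grad_model[where \<psi> = \<psi>, OF assms])
  have Xs: "X \<bullet> sgn x = t"
    by (simp add: X_def t_def inner_add_left inner_diff_left ss)
  have "X \<bullet> d = t\<^sup>2 + b * (d \<bullet> d - t\<^sup>2)"
    by (simp add: X_def t_def inner_add_left inner_diff_left inner_commute[of "sgn x" d] power2_eq_square)
  moreover have "X \<bullet> X = t * (X \<bullet> sgn x) + b * (X \<bullet> d - t * (X \<bullet> sgn x))"
    unfolding t_def by (subst X_def) (simp add: inner_add_left inner_diff_left inner_commute[of "sgn x" X] inner_commute[of d X])
  ultimately have XX: "X \<bullet> X - t * t = b * (b * (d \<bullet> d - t\<^sup>2))"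
    unfolding Xs by (simp add: power2_eq_square)
  have "model_metric \<psi> x X X = t * t + (a * b) * (b * (d \<bullet> d - t\<^sup>2))"
    unfolding model_metric_off_pole[OF assms(1)] Xs XX a_def by simp
  then show ?thesis
    unfolding grad inv by (simp add: t_def b_def power2_eq_square)
qed

text \<open>
  This represents the differential by the Euclidean gradient, whose components are the partial
  derivatives that the class \<open>C\<^sup>k\<close> speaks about.
\<close>

lemma has_derivative_frechet_inner:
  fixes f :: "real ^ 'n::finite \<Rightarrow> real"
  assumes "f differentiable (at x)"
  shows "(f has_derivative (\<lambda>v. (\<chi> i. frechet_derivative f (at x) (axis i 1)) \<bullet> v)) (at x)"
proof -
  let ?D = "frechet_derivative f (at x)"
  have D: "(f has_derivative ?D) (at x)" using assms by (simp add: frechet_derivative_works)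
  then have lin: "linear ?D" by (rule has_derivative_linear)
  have "?D v = (\<chi> i. ?D (axis i 1)) \<bullet> v" for v
  proof -
    have "(\<Sum>i\<in>UNIV. v $ i *\<^sub>R axis i 1) = v"
      unfolding scalar_mult_eq_scaleR[symmetric] by (rule basis_expansion)
    then have "?D v = ?D (\<Sum>i\<in>UNIV. v $ i *\<^sub>R axis i 1)"
      by (rule arg_cong[OF sym])
    also have "\<dots> = (\<Sum>i\<in>UNIV. v $ i * ?D (axis i 1))"
      by (simp add: linear_sum[OF lin] linear_scale[OF lin])
    also have "\<dots> = (\<chi> i. ?D (axis i 1)) \<bullet> v"
      by (simp add: inner_vec_def mult.commute)
    finally show ?thesis .
  qed
  then have "?D = (\<lambda>v. (\<chi> i. ?D (axis i 1)) \<bullet> v)" ..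
  with D show ?thesis by (rule back_subst)
qed

section \<open>The divergence theorem for compactly supported fields\<close>

text \<open>
  By translation invariance of Lebesgue measure every difference quotient of \<open>F\<close> in the direction \<open>v\<close>
  has integral zero; the mean value theorem dominates the quotients, so that the limit may be taken
  under the integral.
\<close>

lemma integral_directional_derivative_compact_support:
  fixes F :: "'a::euclidean_space \<Rightarrow> real"
  assumes S: "compact S"
    and F: "\<And>x. (F has_derivative F' x) (at x)"
    and cont: "continuous_on S (\<lambda>x. F' x v)"
    and zero: "\<And>x. x \<notin> S \<Longrightarrow> F x = 0"
  shows "integrable lborel (\<lambda>x. F' x v)" and "(\<integral>x. F' x v \<partial>lborel) = 0"
proof -
  have zero': "F' x v = 0" if "x \<notin> S" for x
  proof -
    have "(F has_derivative (\<lambda>_. 0)) (at x)"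
    proof (rule has_derivative_transform_within_open[of "\<lambda>_. 0" "\<lambda>_. 0" x UNIV "- S"])
      show "open (- S)" using compact_imp_closed[OF S] by (rule open_Compl)
    qed (use that zero in auto)
    then have "F' x = (\<lambda>_. 0)" using F has_derivative_unique by blast
    then show ?thesis by simp
  qed
  have "(\<lambda>x. F' x v) = (\<lambda>x. indicator S x *\<^sub>R F' x v)"
    by (intro ext) (use zero' in \<open>auto split: split_indicator\<close>)
  then show int_F': "integrable lborel (\<lambda>x. F' x v)"
    using borel_integrable_compact[OF S cont] by simp
  have contF: "continuous_on A F" for A
    using F by (meson continuous_at_imp_continuous_on has_derivative_continuous)
  have "F = (\<lambda>x. indicator S x *\<^sub>R F x)"
    by (intro ext) (use zero in \<open>auto split: split_indicator\<close>)
  then have int_F: "integrable lborel F"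
    using borel_integrable_compact[OF S contF] by simp
  then have [measurable]: "F \<in> borel_measurable borel" by auto
  obtain B0 where B0: "\<And>x. x \<in> S \<Longrightarrow> norm (F' x v) \<le> B0"
    using compact_imp_bounded[OF compact_continuous_image[OF cont S]]
    unfolding bounded_iff by auto
  define B where "B = max 0 B0"
  have B: "\<bar>F' x v\<bar> \<le> B" for x
    using B0[of x] zero'[of x] by (cases "x \<in> S") (auto simp: B_def)
  obtain \<rho> where \<rho>: "\<And>x. x \<in> S \<Longrightarrow> norm x \<le> \<rho>"
    using compact_imp_bounded[OF S] unfolding bounded_iff by auto
  \<comment> \<open>Since \<open>t n \<le> 1\<close>, all difference quotients vanish outside \<open>T\<close>.\<close>
  define T where "T = cball (0::'a) (\<rho> + norm v)"
  define t where "t n = inverse (real (Suc n))" for n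
  have t: "t n > 0" "t n \<le> 1" for n by (auto simp: t_def inverse_eq_divide)
  define q where "q n x = (F (t n *\<^sub>R v + x) - F x) / t n" for n x
  have line: "((\<lambda>s. F (s *\<^sub>R v + x)) has_real_derivative F' (s *\<^sub>R v + x) v) (at s)" for x s
  proof -
    have "((\<lambda>s. s *\<^sub>R v + x) has_derivative (\<lambda>h. h *\<^sub>R v)) (at s)"
      by (auto intro!: derivative_eq_intros)
    from has_derivative_compose[OF this F]
    have "((\<lambda>s. F (s *\<^sub>R v + x)) has_derivative (\<lambda>h. F' (s *\<^sub>R v + x) (h *\<^sub>R v))) (at s)" .
    moreover have "F' y (h *\<^sub>R v) = F' y v * h" for y h
      using linear_scale[OF has_derivative_linear[OF F]] by simp
    ultimately show ?thesis by (simp add: has_field_derivative_def)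
  qed
  have q_bound: "norm (q n x) \<le> indicator T x *\<^sub>R B" for n x
  proof (cases "x \<in> T")
    case True
    obtain z where "F (t n *\<^sub>R v + x) - F (0 *\<^sub>R v + x) = (t n - 0) * F' (z *\<^sub>R v + x) v"
      using MVT2[OF t(1)[of n], of "\<lambda>s. F (s *\<^sub>R v + x)" "\<lambda>s. F' (s *\<^sub>R v + x) v"] line by blast
    then have "q n x = F' (z *\<^sub>R v + x) v" using t(1)[of n] by (simp add: q_def)
    then show ?thesis using B True by simp
  next
    case False
    then have "norm x > \<rho> + norm v" by (simp add: T_def)
    have "norm x \<le> norm (t n *\<^sub>R v + x) + norm (t n *\<^sub>R v)"
      using norm_triangle_ineq4[of "t n *\<^sub>R v + x" "t n *\<^sub>R v"] by simp
    moreover have "norm (t n *\<^sub>R v) \<le> norm v"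
      using t[of n] by (simp add: mult_left_le_one_le)
    ultimately have "norm (t n *\<^sub>R v + x) > \<rho>" "norm x > \<rho>"
      using \<open>norm x > \<rho> + norm v\<close> norm_ge_zero[of v] by linarith+
    then have "t n *\<^sub>R v + x \<notin> S" "x \<notin> S" using \<rho> by (meson not_le)+
    then show ?thesis using zero False by (simp add: q_def)
  qed
  have q_lim: "(\<lambda>n. q n x) \<longlonglongrightarrow> F' x v" for x
  proof -
    have "filterlim t (at 0) sequentially"
      unfolding filterlim_at using LIMSEQ_inverse_real_of_nat t(1)
      by (auto simp: t_def[abs_def] simp del: of_nat_Suc)
    moreover have "((\<lambda>h. (F ((0 + h) *\<^sub>R v + x) - F (0 *\<^sub>R v + x)) / h) \<longlongrightarrow> F' (0 *\<^sub>R v + x) v) (at 0)"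
      using line[of x 0] unfolding DERIV_def .
    ultimately have "(\<lambda>n. (F ((0 + t n) *\<^sub>R v + x) - F (0 *\<^sub>R v + x)) / t n) \<longlonglongrightarrow> F' (0 *\<^sub>R v + x) v"
      using filterlim_compose by blast
    then show ?thesis by (simp add: q_def)
  qed
  have "(\<lambda>n. \<integral>x. q n x \<partial>lborel) \<longlonglongrightarrow> (\<integral>x. F' x v \<partial>lborel)"
  proof (rule integral_dominated_convergence[where w = "\<lambda>x. indicator T x *\<^sub>R B"])
    show "integrable lborel (\<lambda>x. indicator T x *\<^sub>R B)"
      by (rule borel_integrable_compact) (auto simp: T_def)
    show "(\<lambda>x. F' x v) \<in> borel_measurable lborel" using int_F' by auto
    show "q n \<in> borel_measurable lborel" for n unfolding q_def by measurable
  qed (use q_bound q_lim in auto)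
  moreover have "(\<integral>x. q n x \<partial>lborel) = 0" for n
  proof -
    have shift: "integrable lborel (\<lambda>x. F (c + x))" "(\<integral>x. F (c + x) \<partial>lborel) = (\<integral>x. F x \<partial>lborel)" for c
    proof -
      have "integrable (distr lborel borel ((+) c)) F" using int_F by (simp add: lborel_distr_plus)
      then show "integrable lborel (\<lambda>x. F (c + x))" by (subst (asm) integrable_distr_eq) auto
      have "(\<integral>x. F x \<partial>distr lborel borel ((+) c)) = (\<integral>x. F (c + x) \<partial>lborel)"
        by (rule integral_distr) auto
      then show "(\<integral>x. F (c + x) \<partial>lborel) = (\<integral>x. F x \<partial>lborel)" by (simp add: lborel_distr_plus)
    qed
    show ?thesis unfolding q_def using shift int_F by simp
  qed
  ultimately show "(\<integral>x. F' x v \<partial>lborel) = 0"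
    using LIMSEQ_unique[of "\<lambda>n. 0::real"] by auto
qed

lemma integral_divergence_compact_support:
  fixes X :: "real ^ 'n::finite \<Rightarrow> real ^ 'n"
  assumes S: "compact S"
    and X: "\<And>x. (X has_derivative X' x) (at x)"
    and cont: "\<And>i. continuous_on S (\<lambda>x. X' x (axis i 1) $ i)"
    and zero: "\<And>x. x \<notin> S \<Longrightarrow> X x = 0"
  shows "integrable lborel (\<lambda>x. \<Sum>i\<in>UNIV. X' x (axis i 1) $ i)"
    and "(\<integral>x. (\<Sum>i\<in>UNIV. X' x (axis i 1) $ i) \<partial>lborel) = 0"
proof -
  have comp: "((\<lambda>x. X x $ i) has_derivative (\<lambda>v. X' x v $ i)) (at x)" for x i
    using bounded_linear.has_derivative[OF bounded_linear_vec_nth X] .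
  have comp0: "X x $ i = 0" if "x \<notin> S" for x i using zero that by simp
  note * = integral_directional_derivative_compact_support[OF S comp cont comp0]
  show "integrable lborel (\<lambda>x. \<Sum>i\<in>UNIV. X' x (axis i 1) $ i)"
    using *(1) by (rule Bochner_Integration.integrable_sum)
  show "(\<integral>x. (\<Sum>i\<in>UNIV. X' x (axis i 1) $ i) \<partial>lborel) = 0"
    using * by (subst Bochner_Integration.integral_sum) auto
qed

section \<open>Radial fields and the radial Laplacian\<close>

text \<open>
  The vector field \<open>q \<partial>\<^sub>r\<close> multiplied by the Riemannian density \<open>(\<psi>(r) / r)\<^sup>n\<^sup>-\<^sup>1\<close>, with \<open>\<partial>\<^sub>r = x / r\<close>.
  Its Euclidean divergence is the density times the Riemannian divergence of \<open>q \<partial>\<^sub>r\<close>.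
\<close>

definition radial_flux :: "(real \<Rightarrow> real) \<Rightarrow> (real ^ 'n::finite \<Rightarrow> real) \<Rightarrow> real ^ 'n \<Rightarrow> real ^ 'n" where
  "radial_flux \<psi> q x = (\<psi> (norm x) ^ (CARD('n) - 1) / norm x ^ CARD('n) * q x) *\<^sub>R x"

text \<open>
  The second claim is the identity \<open>div (q \<partial>\<^sub>r) = (n - 1) (\<psi>' / \<psi>) q + \<partial>\<^sub>r q\<close>, both sides multiplied by the
  density.  It serves twice: with \<open>q = \<partial>\<^sub>r u\<close> it computes the Laplacian of a radial function, and with
  \<open>q = \<phi>\<^sup>2\<close> it yields the Hardy inequality.
\<close>

lemma radial_flux_has_derivative:
  fixes x :: "real ^ 'n::finite"
  assumes "x \<noteq> 0" and "\<psi> (norm x) > 0"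
    and \<psi>: "(\<psi> has_real_derivative \<psi>') (at (norm x))"
    and q: "(q has_derivative q') (at x)"
  defines "m \<equiv> real (CARD('n) - 1)" and "G \<equiv> \<psi> (norm x) ^ (CARD('n) - 1) / norm x ^ CARD('n)"
  defines "J \<equiv> (\<lambda>v. (G * ((m * (\<psi>' / \<psi> (norm x)) - CARD('n) / norm x) * (sgn x \<bullet> v) * q x + q' v)) *\<^sub>R x
      + (G * q x) *\<^sub>R v)"
  shows "(radial_flux \<psi> q has_derivative J) (at x)"
    and "(\<Sum>i\<in>UNIV. J (axis i 1) $ i) =
      (\<psi> (norm x) / norm x) ^ (CARD('n) - 1) * (m * (\<psi>' / \<psi> (norm x)) * q x + q' (sgn x))"
proof -
  let ?N = "CARD('n)" and ?r = "norm x"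
  have "?r > 0" using assms by simp
  have dpow: "((\<lambda>r. f r ^ k) has_real_derivative k * (f' / f r) * f r ^ k) (at r)"
    if "(f has_real_derivative f') (at r)" "f r > 0" for f f' r and k :: nat
    by (rule DERIV_cong[OF DERIV_power[OF that(1), of k]], cases k) (use that in \<open>auto simp: field_simps\<close>)
  have "((\<lambda>r. \<psi> r ^ (?N - 1) / r ^ ?N) has_real_derivative
      G * (m * (\<psi>' / \<psi> ?r) - ?N / ?r)) (at ?r)"
    by (rule DERIV_cong[OF DERIV_divide[OF dpow[OF \<psi>, of "?N - 1"] dpow[OF DERIV_ident, of _ ?N]]])
       (use assms in \<open>auto simp: G_def m_def field_simps\<close>)
  then have "((\<lambda>y. \<psi> (norm y) ^ (?N - 1) / norm y ^ ?N) has_derivative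
      (\<lambda>v. G * (m * (\<psi>' / \<psi> ?r) - ?N / ?r) * (sgn x \<bullet> v))) (at x)"
    unfolding has_field_derivative_def
    using has_derivative_compose[OF has_derivative_norm[OF assms(1)]] by (simp add: inner_commute)
  from has_derivative_scaleR[OF has_derivative_mult[OF this q] has_derivative_ident]
  show "(radial_flux \<psi> q has_derivative J) (at x)"
    unfolding radial_flux_def J_def G_def[symmetric]
    by (rule has_derivative_eq_rhs) (simp add: distrib_left mult_ac add_ac)
  have lin: "linear q'" using q by (rule has_derivative_linear)
  have exp: "(\<Sum>i\<in>UNIV. x $ i *\<^sub>R axis i 1) = x"
    unfolding scalar_mult_eq_scaleR[symmetric] by (rule basis_expansion)
  have q': "(\<Sum>i\<in>UNIV. q' (axis i 1) * x $ i) = q' x"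
    using arg_cong[OF exp, of q'] by (simp add: linear_sum[OF lin] linear_scale[OF lin] mult.commute)
  have qs: "q' x = ?r * q' (sgn x)"
    using linear_scale[OF lin, of ?r "sgn x"] \<open>?r > 0\<close> by (simp add: sgn_div_norm)
  have sx: "(\<Sum>i\<in>UNIV. sgn x $ i * x $ i) = ?r"
  proof -
    have "sgn x \<bullet> x = ?r" using \<open>?r > 0\<close> by (simp add: sgn_div_norm dot_square_norm power2_eq_square)
    then show ?thesis by (simp add: inner_vec_def)
  qed
  define \<alpha> where "\<alpha> = (m * (\<psi>' / \<psi> ?r) - ?N / ?r) * q x"
  have "(\<Sum>i\<in>UNIV. J (axis i 1) $ i) =
      (\<Sum>i\<in>UNIV. (G * \<alpha>) * (sgn x $ i * x $ i) + G * (q' (axis i 1) * x $ i) + G * q x)"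
    by (rule sum.cong) (simp_all add: J_def \<alpha>_def inner_axis algebra_simps)
  also have "\<dots> = G * \<alpha> * ?r + G * q' x + ?N * (G * q x)"
    unfolding sum.distrib sum_distrib_left[symmetric] sx q' by simp
  also have "\<dots> = G * ?r * (m * (\<psi>' / \<psi> ?r) * q x + q' (sgn x))"
    unfolding qs \<alpha>_def using \<open>?r > 0\<close> by (simp add: field_simps)
  also have "G * ?r = (\<psi> ?r / ?r) ^ (?N - 1)"
    using \<open>?r > 0\<close> power_minus_mult[of ?N ?r] by (simp add: G_def power_divide field_simps)
  finally show "(\<Sum>i\<in>UNIV. J (axis i 1) $ i) =
      (\<psi> ?r / ?r) ^ (?N - 1) * (m * (\<psi>' / \<psi> ?r) * q x + q' (sgn x))" .
qed

lemma riem_laplacian_radial: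
  fixes u :: "real ^ 'n::finite \<Rightarrow> real"
  assumes "x \<noteq> 0" and u: "\<And>y. y \<noteq> 0 \<Longrightarrow> u y = f (norm y)"
    and \<psi>_pos: "\<And>r. r > 0 \<Longrightarrow> \<psi> r > 0"
    and \<psi>: "(\<psi> has_real_derivative \<psi>') (at (norm x))"
    and f: "\<And>r. r > 0 \<Longrightarrow> (f has_real_derivative f1 r) (at r)"
    and f1: "(f1 has_real_derivative f2) (at (norm x))"
  shows "riem_laplacian (model_metric \<psi>) u x =
    f2 + real (CARD('n) - 1) * (\<psi>' / \<psi> (norm x)) * f1 (norm x)"
proof -
  let ?g = "model_metric \<psi> :: 'n metric_tensor" and ?q = "\<lambda>y :: real ^ 'n. f1 (norm y)"
  let ?w = "(\<psi> (norm x) / norm x) ^ (CARD('n) - 1)"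
  have norm_der: "((\<lambda>y :: real ^ 'n. F (norm y)) has_derivative (\<lambda>v. F' * (sgn y \<bullet> v))) (at y)"
    if "y \<noteq> 0" "(F has_real_derivative F') (at (norm y))" for F F' y
    using has_derivative_compose[OF has_derivative_norm[OF that(1)] that(2)[unfolded has_field_derivative_def]]
    by (simp add: inner_commute[of _ "sgn y"])
  have grad: "riem_grad ?g u y = f1 (norm y) *\<^sub>R sgn y" if "y \<noteq> 0" for y
  proof -
    have "((\<lambda>y. f (norm y)) has_derivative (\<lambda>v. (f1 (norm y) *\<^sub>R sgn y) \<bullet> v)) (at y)"
      using norm_der[OF that f] that by simp
    then have "(u has_derivative (\<lambda>v. (f1 (norm y) *\<^sub>R sgn y) \<bullet> v)) (at y)"
      by (rule has_derivative_transform_within_open[of _ _ _ UNIV "- {0}"]) (use that u in auto)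
    moreover have "sgn y \<bullet> sgn y = 1" using that by (simp add: dot_square_norm norm_sgn)
    ultimately show ?thesis
      using riem_grad_model[where \<psi> = \<psi>, OF that \<psi>_pos, of u "f1 (norm y) *\<^sub>R sgn y"] that by simp
  qed
  have flux: "radial_flux \<psi> ?q y = riem_density ?g y *\<^sub>R riem_grad ?g u y" if "y \<noteq> 0" for y
  proof -
    have "norm y ^ CARD('n) = norm y ^ (CARD('n) - 1) * norm y"
      using power_minus_mult[of "CARD('n)" "norm y"] by simp
    then show ?thesis
      using that \<psi>_pos
      by (simp add: radial_flux_def riem_density_model grad sgn_div_norm power_mult_distrib power_inverse divide_inverse mult_ac)
  qed
  have q: "(?q has_derivative (\<lambda>v. f2 * (sgn x \<bullet> v))) (at x)"
    using norm_der[OF assms(1) f1] .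
  have pos: "\<psi> (norm x) > 0" using assms(1) \<psi>_pos by simp
  obtain J where J: "(radial_flux \<psi> ?q has_derivative J) (at x)"
    "(\<Sum>i\<in>UNIV. J (axis i 1) $ i) =
      ?w * (real (CARD('n) - 1) * (\<psi>' / \<psi> (norm x)) * f1 (norm x) + f2 * (sgn x \<bullet> sgn x))"
    using radial_flux_has_derivative[OF assms(1) pos \<psi> q] by blast
  have "frechet_derivative (\<lambda>y. riem_density ?g y * riem_grad ?g u y $ i) (at x) = (\<lambda>v. J v $ i)" for i
  proof -
    have "((\<lambda>y. radial_flux \<psi> ?q y $ i) has_derivative (\<lambda>v. J v $ i)) (at x)"
      using bounded_linear.has_derivative[OF bounded_linear_vec_nth J(1)] .
    then have "((\<lambda>y. riem_density ?g y * riem_grad ?g u y $ i) has_derivative (\<lambda>v. J v $ i)) (at x)"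
      by (rule has_derivative_transform_within_open[of _ _ _ UNIV "- {0}"]) (use assms(1) flux in auto)
    then show ?thesis by (rule frechet_derivative_at[symmetric])
  qed
  then have "riem_laplacian ?g u x = (\<Sum>i\<in>UNIV. J (axis i 1) $ i) / ?w"
    unfolding riem_laplacian_def riem_div_def riem_density_model[where \<psi> = \<psi>, OF assms(1) pos] by simp
  moreover have "sgn x \<bullet> sgn x = 1" using assms(1) by (simp add: dot_square_norm norm_sgn)
  ultimately show ?thesis
    unfolding J(2) using pos assms(1) by simp
qed

section \<open>The Hardy inequality and stability outside a ball\<close>

text \<open>
  On the support of a test function the mean curvature \<open>(n - 1) \<psi>' / \<psi>\<close> of the geodesic spheres is at
  least \<open>c\<close>.  The square \<open>(\<partial>\<^sub>r \<phi> + c \<phi> / 2)\<^sup>2 \<ge> 0\<close> then gives the pointwise bound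
  \<open>\<bar>\<nabla>\<phi>\<bar>\<^sup>2 - (c\<^sup>2 / 4) \<phi>\<^sup>2 \<ge> - (c / 2) div (\<phi>\<^sup>2 \<partial>\<^sub>r)\<close>, and the divergence has integral zero.  This is
  the Hardy inequality \<open>\<integral> \<bar>\<nabla>\<phi>\<bar>\<^sup>2 \<ge> (c\<^sup>2 / 4) \<integral> \<phi>\<^sup>2\<close>, which dominates the potential term.
\<close>

lemma stable_outside_cball:
  fixes u :: "real ^ 'n::finite \<Rightarrow> real"
  assumes "R \<ge> 0" and "p > 1" and u: "continuous_on UNIV u"
    and \<psi>: "\<And>r. r > 0 \<Longrightarrow> (\<psi> has_real_derivative \<psi>' r) (at r)"
    and \<psi>': "continuous_on {0<..} \<psi>'"
    and \<psi>_pos: "\<And>r. r > 0 \<Longrightarrow> \<psi> r > 0"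
    and "c \<ge> 0" and mean_curvature: "\<And>r. r > R \<Longrightarrow> c \<le> real (CARD('n) - 1) * (\<psi>' r / \<psi> r)"
    and potential: "\<And>x. norm x > R \<Longrightarrow> p * \<bar>u x\<bar> powr (p - 1) \<le> c\<^sup>2 / 4"
  shows "stable_outside (model_metric \<psi>) p u (cball 0 R)"
  unfolding stable_outside_def
proof
  fix \<phi> :: "real ^ 'n \<Rightarrow> real"
  assume \<phi>: "\<phi> \<in> test_functions (cball 0 R)"
  let ?g = "model_metric \<psi> :: 'n metric_tensor" and ?m = "real (CARD('n) - 1)"
  define S where "S = closure {x. \<phi> x \<noteq> 0}"
  define w where "w x = (\<psi> (norm x) / norm x) ^ (CARD('n) - 1)" for x :: "real ^ 'n"
  have S: "compact S" "S \<subseteq> - cball 0 R" and smooth: "Ck (Suc 0) \<phi>"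
    using \<phi> unfolding test_functions_def S_def by blast+
  have S_norm: "norm x > R" "norm x > 0" "x \<noteq> 0" "\<psi> (norm x) > 0" if "x \<in> S" for x
  proof -
    have "x \<in> - cball 0 R" using S(2) that by (rule subsetD)
    then show "norm x > R" by simp
    then show "norm x > 0" using \<open>R \<ge> 0\<close> by linarith
    then show "x \<noteq> 0" "\<psi> (norm x) > 0" using \<psi>_pos by auto
  qed
  have S_ne: "norm x \<noteq> 0" "\<psi> (norm x) \<noteq> 0" if "x \<in> S" for x
    using S_norm(2,4)[OF that] by linarith+
  have \<phi>0: "\<phi> x = 0" if "x \<notin> S" for x
    using that subsetD[OF closure_subset, of x "{x. \<phi> x \<noteq> 0}"] unfolding S_def by (cases "\<phi> x = 0") simp_all
  define d where "d x = (\<chi> i. frechet_derivative \<phi> (at x) (axis i 1))" for x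
  have d: "(\<phi> has_derivative (\<lambda>v. d x \<bullet> v)) (at x)" for x
    unfolding d_def using smooth by (intro has_derivative_frechet_inner) simp
  have cont_d: "continuous_on S d"
  proof -
    have "continuous_on UNIV (\<lambda>x. frechet_derivative \<phi> (at x) (axis i 1))" for i
      using smooth by simp
    then show ?thesis
      unfolding d_def by (intro continuous_on_vec_lambda) (rule continuous_on_subset[OF _ subset_UNIV])
  qed
  have cont_\<phi>: "continuous_on S \<phi>"
    by (intro continuous_at_imp_continuous_on ballI has_derivative_continuous[OF d])
  have open_S: "open (- S)" using compact_imp_closed[OF S(1)] by (rule open_Compl)
  have d0: "d x = 0" if "x \<notin> S" for x
  proof -
    have "(\<phi> has_derivative (\<lambda>_. 0)) (at x)"
      by (rule has_derivative_transform_within_open[of "\<lambda>_. 0" "\<lambda>_. 0" x UNIV "- S"])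
         (use that \<phi>0 open_S in auto)
    from has_derivative_unique[OF d this] have "d x \<bullet> d x = 0" by (rule fun_cong)
    then show ?thesis by simp
  qed
  have pole: "0 \<notin> S" using S_norm(3)[of 0] by argo
  have cont_\<psi>: "continuous_on {0<..} \<psi>"
    using \<psi> by (auto intro!: continuous_at_imp_continuous_on DERIV_isCont)
  have cont_\<psi>n: "continuous_on A (\<lambda>x :: real ^ 'n. \<psi> (norm x))"
    and cont_\<psi>'n: "continuous_on A (\<lambda>x :: real ^ 'n. \<psi>' (norm x))" if "0 \<notin> A" for A
  proof -
    have "norm ` A \<subseteq> {0<..}" using that by auto
    then show "continuous_on A (\<lambda>x :: real ^ 'n. \<psi> (norm x))" "continuous_on A (\<lambda>x :: real ^ 'n. \<psi>' (norm x))"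
      by (rule continuous_on_compose2[OF cont_\<psi> continuous_on_norm_id]
          continuous_on_compose2[OF \<psi>' continuous_on_norm_id])+
  qed
  have cont_sgn: "continuous_on A (sgn :: real ^ 'n \<Rightarrow> _)" if "0 \<notin> A" for A
    using that by (intro continuous_on_sgn continuous_on_id) auto
  have cont_w: "continuous_on A w" if "0 \<notin> A" for A
    unfolding w_def using that by (intro continuous_intros cont_\<psi>n) auto

  \<comment> \<open>The differential of the flux of \<open>\<phi>\<^sup>2 \<partial>\<^sub>r\<close>; off \<open>S\<close> the flux vanishes identically, also near the pole.\<close>
  define X' where "X' x = (if x \<in> S then (\<lambda>v.
      (\<psi> (norm x) ^ (CARD('n) - 1) / norm x ^ CARD('n) *
        ((?m * (\<psi>' (norm x) / \<psi> (norm x)) - CARD('n) / norm x) * (sgn x \<bullet> v) * (\<phi> x)\<^sup>2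
          + 2 * \<phi> x * (d x \<bullet> v))) *\<^sub>R x
      + (\<psi> (norm x) ^ (CARD('n) - 1) / norm x ^ CARD('n) * (\<phi> x)\<^sup>2) *\<^sub>R v) else (\<lambda>_. 0))" for x
  have X0: "radial_flux \<psi> (\<lambda>x. (\<phi> x)\<^sup>2) x = 0" if "x \<notin> S" for x
    using \<phi>0 that by (simp add: radial_flux_def)
  have \<phi>2: "((\<lambda>x. (\<phi> x)\<^sup>2) has_derivative (\<lambda>v. 2 * \<phi> x * (d x \<bullet> v))) (at x)" for x
    using has_derivative_power[OF d, where n = 2] by (simp add: mult_ac)
  have X: "(radial_flux \<psi> (\<lambda>x. (\<phi> x)\<^sup>2) has_derivative X' x) (at x)" for x
  proof (cases "x \<in> S")
    case True
    from radial_flux_has_derivative(1)[OF S_norm(3,4) \<psi> \<phi>2, OF True True S_norm(2)[OF True]]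
    show ?thesis unfolding X'_def if_P[OF True] .
  next
    case False
    have "(radial_flux \<psi> (\<lambda>x. (\<phi> x)\<^sup>2) has_derivative (\<lambda>_. 0)) (at x)"
      by (rule has_derivative_transform_within_open[of "\<lambda>_. 0" "\<lambda>_. 0" x UNIV "- S"])
         (use False X0 open_S in auto)
    then show ?thesis using False by (simp add: X'_def)
  qed
  define D where "D x = (\<Sum>i\<in>UNIV. X' x (axis i 1) $ i)" for x
  have D_S: "D x = w x * (?m * (\<psi>' (norm x) / \<psi> (norm x)) * (\<phi> x)\<^sup>2 + 2 * \<phi> x * (d x \<bullet> sgn x))" if "x \<in> S" for x
    using radial_flux_has_derivative(2)[OF S_norm(3,4) \<psi> \<phi>2, OF that that S_norm(2)[OF that]]
    unfolding D_def X'_def if_P[OF that] w_def .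
  have cont_X': "continuous_on S (\<lambda>x. X' x (axis i 1) $ i)" for i
  proof -
    have c1: "continuous_on S (\<lambda>x. \<psi> (norm x) ^ (CARD('n) - 1) / norm x ^ CARD('n))"
      using S_ne by (intro continuous_on_divide continuous_on_power cont_\<psi>n[OF pole] continuous_on_norm_id) auto
    have c2: "continuous_on S (\<lambda>x. ?m * (\<psi>' (norm x) / \<psi> (norm x)) - CARD('n) / norm x)"
      using S_ne by (intro continuous_on_diff continuous_on_mult continuous_on_const continuous_on_divide
          cont_\<psi>n[OF pole] cont_\<psi>'n[OF pole] continuous_on_norm_id) auto
    have c3: "continuous_on S (\<lambda>x. f x \<bullet> axis i 1)" if "continuous_on S f" for f :: "real ^ 'n \<Rightarrow> real ^ 'n"
      using that by (intro continuous_on_inner continuous_on_const)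
    have c4: "continuous_on S (\<lambda>x. (\<phi> x)\<^sup>2)" using cont_\<phi> by (rule continuous_on_power)
    have "continuous_on S (\<lambda>x. ((\<psi> (norm x) ^ (CARD('n) - 1) / norm x ^ CARD('n) *
        ((?m * (\<psi>' (norm x) / \<psi> (norm x)) - CARD('n) / norm x) * (sgn x \<bullet> axis i 1) * (\<phi> x)\<^sup>2
          + 2 * \<phi> x * (d x \<bullet> axis i 1))) *\<^sub>R x
      + (\<psi> (norm x) ^ (CARD('n) - 1) / norm x ^ CARD('n) * (\<phi> x)\<^sup>2) *\<^sub>R axis i 1) $ i)"
      by (intro continuous_on_component continuous_on_add continuous_on_scaleR continuous_on_mult
          continuous_on_const continuous_on_id c1 c2 c3 c4 cont_d cont_\<phi> cont_sgn[OF pole])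
    then show ?thesis
      by (rule continuous_on_eq) (simp only: X'_def if_True)
  qed
  have int_D: "integrable lborel D" "(\<integral>x. D x \<partial>lborel) = 0"
    unfolding D_def using integral_divergence_compact_support[OF S(1) X cont_X' X0] by simp_all

  \<comment> \<open>\<open>P\<close> is the squared Riemannian norm of the gradient, with \<open>d \<bullet> sgn x\<close> the radial derivative.\<close>
  define P where "P x = (d x \<bullet> sgn x)\<^sup>2 + (norm x / \<psi> (norm x))\<^sup>2 * (d x \<bullet> d x - (d x \<bullet> sgn x)\<^sup>2)" for x
  define Q where "Q x = \<bar>u x\<bar> powr (p - 1) * (\<phi> x)\<^sup>2" for x
  have grad: "?g x (riem_grad ?g \<phi> x) (riem_grad ?g \<phi> x) = P x" if "x \<noteq> 0" for x
    unfolding P_def using norm_riem_grad_model[where \<psi> = \<psi>, OF that _ d] that \<psi>_pos by simp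
  have cont_P: "continuous_on S P"
    unfolding P_def using S_ne
    by (intro continuous_on_add continuous_on_diff continuous_on_mult continuous_on_power continuous_on_divide
        continuous_on_inner continuous_on_norm_id cont_\<psi>n[OF pole] cont_d cont_sgn[OF pole]) auto
  have cont_Q: "continuous_on S Q"
  proof -
    have "continuous_on S (\<lambda>x. \<bar>u x\<bar> powr (p - 1))"
      using \<open>p > 1\<close> by (intro continuous_on_powr' continuous_intros continuous_on_subset[OF u subset_UNIV]) auto
    then show ?thesis unfolding Q_def by (intro continuous_on_mult continuous_on_power cont_\<phi>)
  qed
  have w_pos: "w x > 0" if "x \<noteq> 0" for x
    using that \<psi>_pos by (simp add: w_def)
  have density: "riem_density ?g x = (if x = 0 then 1 else w x)" for x
    using \<psi>_pos by (simp add: riem_density_model riem_density_pole w_def)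
  have density_nonneg: "riem_density ?g x \<ge> 0" for x
    using w_pos[of x] by (simp add: density less_imp_le)
  have meas_density: "(riem_density ?g) \<in> borel_measurable borel"
  proof -
    have "(\<lambda>x. indicator (- {0}) x *\<^sub>R w x) \<in> borel_measurable borel"
      by (rule borel_measurable_continuous_on_indicator) (auto intro: cont_w)
    then have "(\<lambda>x. if x = 0 then 1 else indicator (- {0}) x *\<^sub>R w x) \<in> borel_measurable borel"
      by measurable
    also have "(\<lambda>x. if x = 0 then 1 else indicator (- {0}) x *\<^sub>R w x) = riem_density ?g"
      by (auto simp: density)
    finally show ?thesis .
  qed
  have integrable_weighted: "integrable lborel (\<lambda>x. indicator S x *\<^sub>R (w x * H x))"
    if "continuous_on S H" for H
    using S(1) that cont_w[OF pole] by (intro borel_integrable_compact continuous_on_mult)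
  \<comment> \<open>Integrals outside the ball become Lebesgue integrals of functions that are continuous on \<open>S\<close>.\<close>
  have transfer: "(LINT x:- cball 0 R|riem_vol ?g. F x) = (\<integral>x. indicator S x *\<^sub>R (w x * H x) \<partial>lborel)"
    if H: "continuous_on S H" and FH: "\<And>x. x \<in> S \<Longrightarrow> F x = H x"
      and F0: "\<And>x. norm x > R \<Longrightarrow> x \<notin> S \<Longrightarrow> F x = 0" for F H
  proof -
    have eq: "indicator (- cball 0 R) x *\<^sub>R F x = indicator S x *\<^sub>R H x" for x
      using FH F0 S(2) by (auto split: split_indicator simp: subset_iff)
    have "(\<lambda>x. indicator S x *\<^sub>R H x) \<in> borel_measurable borel"
      using borel_integrable_compact[OF S(1) H] by auto
    then have "(LINT x:- cball 0 R|riem_vol ?g. F x) = (\<integral>x. riem_density ?g x *\<^sub>R (indicator S x *\<^sub>R H x) \<partial>lborel)"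
      unfolding set_lebesgue_integral_def eq riem_vol_def using meas_density density_nonneg
      by (intro integral_density) auto
    also have "\<dots> = (\<integral>x. indicator S x *\<^sub>R (w x * H x) \<partial>lborel)"
      using pole by (intro Bochner_Integration.integral_cong) (auto simp: density split: split_indicator)
    finally show "(LINT x:- cball 0 R|riem_vol ?g. F x) = (\<integral>x. indicator S x *\<^sub>R (w x * H x) \<partial>lborel)" .
  qed
  have P: "(LINT x:- cball 0 R|riem_vol ?g. ?g x (riem_grad ?g \<phi> x) (riem_grad ?g \<phi> x)) =
      (\<integral>x. indicator S x *\<^sub>R (w x * P x) \<partial>lborel)"
  proof (rule transfer[OF cont_P])
    show "?g x (riem_grad ?g \<phi> x) (riem_grad ?g \<phi> x) = P x" if "x \<in> S" for x
      using grad[OF S_norm(3)[OF that]] .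
    show "?g x (riem_grad ?g \<phi> x) (riem_grad ?g \<phi> x) = 0" if "norm x > R" "x \<notin> S" for x
    proof -
      have "x \<noteq> 0" using that(1) \<open>R \<ge> 0\<close> by auto
      then show ?thesis unfolding grad[OF \<open>x \<noteq> 0\<close>] P_def d0[OF that(2)] by simp
    qed
  qed
  have Q: "(LINT x:- cball 0 R|riem_vol ?g. Q x) = (\<integral>x. indicator S x *\<^sub>R (w x * Q x) \<partial>lborel)"
    by (rule transfer[OF cont_Q]) (simp_all add: Q_def \<phi>0)
  have int_P: "integrable lborel (\<lambda>x. indicator S x *\<^sub>R (w x * P x))"
    and int_Q: "integrable lborel (\<lambda>x. indicator S x *\<^sub>R (w x * Q x))"
    by (rule integrable_weighted[OF cont_P] integrable_weighted[OF cont_Q])+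
  have pointwise: "- (c / 2) * D x \<le> indicator S x *\<^sub>R (w x * P x) - p * (indicator S x *\<^sub>R (w x * Q x))" for x
  proof (cases "x \<in> S")
    case True
    let ?t = "d x \<bullet> sgn x" and ?a = "?m * (\<psi>' (norm x) / \<psi> (norm x))"
    have "(norm (sgn x))\<^sup>2 = 1" using S_norm(3)[OF True] by (simp add: norm_sgn)
    then have "?t\<^sup>2 \<le> d x \<bullet> d x"
      using Cauchy_Schwarz_ineq[of "d x" "sgn x"] by (simp add: power2_norm_eq_inner)
    then have 1: "?t\<^sup>2 \<le> P x" by (simp add: P_def)
    have 2: "p * Q x \<le> c\<^sup>2 / 4 * (\<phi> x)\<^sup>2"
      using mult_right_mono[OF potential[OF S_norm(1)[OF True]], of "(\<phi> x)\<^sup>2"] by (simp add: Q_def)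
    have 3: "c / 2 * (c * (\<phi> x)\<^sup>2) \<le> c / 2 * (?a * (\<phi> x)\<^sup>2)"
      using mean_curvature[OF S_norm(1)[OF True]] \<open>c \<ge> 0\<close> by (intro mult_left_mono mult_right_mono) auto
    have "0 \<le> (?t + c / 2 * \<phi> x)\<^sup>2" by simp
    also have "\<dots> = ?t\<^sup>2 + c / 2 * (2 * \<phi> x * ?t) + c / 2 * (c * (\<phi> x)\<^sup>2) - c\<^sup>2 / 4 * (\<phi> x)\<^sup>2"
      by (simp add: power2_eq_square algebra_simps)
    finally have "- (c / 2) * (?a * (\<phi> x)\<^sup>2 + 2 * \<phi> x * ?t) \<le> P x - p * Q x"
      using 1 2 3 by (simp add: distrib_left)
    then have "w x * (- (c / 2) * (?a * (\<phi> x)\<^sup>2 + 2 * \<phi> x * ?t)) \<le> w x * (P x - p * Q x)"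
      using w_pos[OF S_norm(3)[OF True]] by (intro mult_left_mono) auto
    then show ?thesis using True by (simp add: D_S algebra_simps)
  next
    case False
    then show ?thesis by (simp add: D_def X'_def)
  qed
  have "0 = (\<integral>x. - (c / 2) * D x \<partial>lborel)" using int_D by simp
  also have "\<dots> \<le> (\<integral>x. indicator S x *\<^sub>R (w x * P x) - p * (indicator S x *\<^sub>R (w x * Q x)) \<partial>lborel)"
    using int_D(1) int_P int_Q pointwise
    by (intro integral_mono Bochner_Integration.integrable_diff integrable_mult_right) auto
  also have "\<dots> = (\<integral>x. indicator S x *\<^sub>R (w x * P x) \<partial>lborel) - p * (\<integral>x. indicator S x *\<^sub>R (w x * Q x) \<partial>lborel)"
    by (simp only: Bochner_Integration.integral_diff[OF int_P integrable_mult_right[OF int_Q]]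
        integral_mult_right_zero)
  finally show "(LINT x:- cball 0 R|riem_vol ?g. ?g x (riem_grad ?g \<phi> x) (riem_grad ?g \<phi> x))
      - p * (LINT x:- cball 0 R|riem_vol ?g. \<bar>u x\<bar> powr (p - 1) * (\<phi> x)\<^sup>2) \<ge> 0"
    unfolding P Q[unfolded Q_def] by (simp add: Q_def)
qed

section \<open>Radial solutions\<close>

theorem theorem2p15:
  fixes \<psi> \<psi>' \<psi>'' :: "real \<Rightarrow> real" and p :: real and u :: "real ^ 'n::finite \<Rightarrow> real"
  assumes "CARD('n) \<ge> 3" and "p > 1"
    and "\<And>r. r \<ge> 0 \<Longrightarrow> (\<psi> has_real_derivative \<psi>' r) (at r within {0..})"
    and "\<And>r. r \<ge> 0 \<Longrightarrow> (\<psi>' has_real_derivative \<psi>'' r) (at r within {0..})"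
    and "continuous_on {0..} \<psi>''"
    and "\<And>r. r > 0 \<Longrightarrow> \<psi> r > 0"
    and "\<psi> 0 = 0" and "\<psi>'' 0 = 0" and "\<psi>' 0 = 1"
    and "\<And>r. r > 0 \<Longrightarrow> \<psi>' r \<ge> 0"
    and "Liminf at_top (\<lambda>r. ereal (\<psi>' r / \<psi> r)) > 0"
    and "Limsup at_top (\<lambda>r. ereal (\<psi>' r / \<psi> r)) < \<infinity> \<or>
         (Liminf at_top (\<lambda>r. ereal (\<psi>' r / \<psi> r)) = \<infinity> \<and>
          deriv (\<lambda>r. ln (\<psi>' r / \<psi> r)) \<in> O[at_top](\<lambda>_. 1) \<and>
          (\<exists>r0 \<ge> 0. (\<forall>r \<ge> r0. \<psi>' r > 0) \<and>
             \<not> set_integrable lborel {r0<..} (\<lambda>r. \<psi> r / \<psi>' r)))"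
    and "radial u"
    and "lane_emden_solution (model_metric \<psi>) p u"
  shows "stable_outside_compact (model_metric \<psi>) p u"
proof -
  define h where "h r = \<psi>' r / \<psi> r" for r
  define m where "m = real (CARD('n) - 1)"
  have "m \<ge> 1" using assms(1) by (simp add: m_def)
  have interior: "(F has_real_derivative F') (at r)"
    if "r > 0" "(F has_real_derivative F') (at r within {0..})" for F F' r
    using that at_within_interior[of r "{0..}"] by (simp add: interior_real_atLeast)
  have \<psi>: "(\<psi> has_real_derivative \<psi>' r) (at r)" if "r > 0" for r
    using interior[OF that assms(3)] that by simp
  have \<psi>': "continuous_on {0<..} \<psi>'"
    using interior[OF _ assms(4)] by (auto intro!: continuous_at_imp_continuous_on DERIV_isCont)
  have h_nonneg: "h r \<ge> 0" if "r > 0" for r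
    using assms(6,10)[OF that] by (simp add: h_def)

  obtain e :: "real ^ 'n" where e: "norm e = 1"
    using vector_choose_size[of 1] by auto
  \<comment> \<open>The radial profile of \<open>u\<close>, read off along a line through the pole.\<close>
  define f where "f r = u (r *\<^sub>R e)" for r
  define f1 where "f1 r = frechet_derivative u (at (r *\<^sub>R e)) e" for r
  define f2 where "f2 r = frechet_derivative (\<lambda>y. frechet_derivative u (at y) e) (at (r *\<^sub>R e)) e" for r
  have u_f: "u x = f (norm x)" for x
  proof -
    obtain g where "\<And>x. u x = g (norm x)" using assms(13) unfolding radial_def by blast
    then show ?thesis using e by (simp add: f_def)
  qed
  have C2: "Ck (Suc (Suc 0)) u"
    using assms(14) by (simp add: lane_emden_solution_def numeral_2_eq_2)
  have u_diff: "u differentiable (at x)" "(\<lambda>y. frechet_derivative u (at y) e) differentiable (at x)" for x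
    using C2 by simp_all
  have u_cont: "continuous_on UNIV u"
    using u_diff(1) by (simp add: continuous_at_imp_continuous_on differentiable_imp_continuous_within)
  have along: "((\<lambda>r. F (r *\<^sub>R e)) has_real_derivative frechet_derivative F (at (r *\<^sub>R e)) e) (at r)"
    if "\<And>x. F differentiable (at x)" for F :: "real ^ 'n \<Rightarrow> real" and r
  proof -
    let ?D = "frechet_derivative F (at (r *\<^sub>R e))"
    have D: "(F has_derivative ?D) (at (r *\<^sub>R e))"
      using that frechet_derivative_works by blast
    have "((\<lambda>r. r *\<^sub>R e) has_derivative (\<lambda>h. h *\<^sub>R e)) (at r)"
      by (auto intro!: derivative_eq_intros)
    from has_derivative_compose[OF this D]
    have "((\<lambda>r. F (r *\<^sub>R e)) has_derivative (\<lambda>h. ?D (h *\<^sub>R e))) (at r)" .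
    moreover have "(\<lambda>h. ?D (h *\<^sub>R e)) = (*) (?D e)"
      by (simp add: fun_eq_iff linear_scale[OF has_derivative_linear[OF D]])
    ultimately show ?thesis unfolding has_field_derivative_def by simp
  qed
  have f: "(f has_real_derivative f1 r) (at r)" and f1: "(f1 has_real_derivative f2 r) (at r)" for r
    unfolding f_def[abs_def] f1_def[abs_def] f2_def using along[OF u_diff(1)] along[OF u_diff(2)] by blast+
  have ode: "(f1 has_real_derivative - (m * h r) * f1 r - \<bar>f r\<bar> powr (p - 1) * f r) (at r)" if "r > 0" for r
  proof -
    let ?x = "r *\<^sub>R e"
    have x: "?x \<noteq> 0" "norm ?x = r" using that e by auto
    have "riem_laplacian (model_metric \<psi>) u ?x = f2 r + m * h r * f1 r"
      using riem_laplacian_radial[where \<psi> = \<psi> and u = u and x = ?x and f = f and ?f1.0 = f1, OF x(1) u_f assms(6) _ f f1] \<psi>[OF that] x(2)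
      by (simp add: m_def h_def)
    moreover have "- riem_laplacian (model_metric \<psi>) u ?x = \<bar>u ?x\<bar> powr (p - 1) * u ?x"
      using assms(14) unfolding lane_emden_solution_def by blast
    ultimately have "f2 r = - (m * h r) * f1 r - \<bar>f r\<bar> powr (p - 1) * f r"
      by (simp add: f_def)
    then show ?thesis using f1[of r] by simp
  qed
  have damping: "m * h r \<ge> 0" if "r > 0" for r using h_nonneg[OF that] \<open>m \<ge> 1\<close> by simp

  have "\<exists>c R. c \<ge> 0 \<and> R > 0 \<and> (\<forall>r>R. c \<le> m * h r \<and> p * \<bar>f r\<bar> powr (p - 1) \<le> c\<^sup>2 / 4)"
    using assms(12)
  proof
    assume "Limsup at_top (\<lambda>r. ereal (\<psi>' r / \<psi> r)) < \<infinity>"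
    then obtain C where "Limsup at_top (\<lambda>r. ereal (\<psi>' r / \<psi> r)) < ereal C"
      using ereal_dense2 by blast
    from Limsup_lessD[OF this] have upper: "eventually (\<lambda>r. h r < C) at_top" by (simp add: h_def)
    obtain c where "0 < ereal c" "ereal c < Liminf at_top (\<lambda>r. ereal (\<psi>' r / \<psi> r))"
      using ereal_dense2[OF assms(11)] by blast
    from less_LiminfD[OF this(2)] have lower: "eventually (\<lambda>r. c < h r) at_top" by (simp add: h_def)
    have "c > 0" using \<open>0 < ereal c\<close> by simp
    obtain R0 where R0: "\<And>r. r \<ge> R0 \<Longrightarrow> c < h r \<and> h r < C"
      using eventually_conj[OF lower upper] unfolding eventually_at_top_linorder by blast
    \<comment> \<open>The solution \<open>\<eta>\<close> of \<open>p * \<eta> powr (p - 1) = (m * c)\<^sup>2 / 4\<close>: below this amplitude Hardy's inequality wins.\<close>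
    define \<eta> where "\<eta> = ((m * c)\<^sup>2 / (4 * p)) powr (1 / (p - 1))"
    have "m * c > 0" using \<open>c > 0\<close> \<open>m \<ge> 1\<close> by simp
    have "\<eta> > 0" using assms(2) \<open>c > 0\<close> \<open>m \<ge> 1\<close> by (simp add: \<eta>_def)
    have bounds: "m * c \<le> m * h r" "m * h r \<le> m * C" if "r \<ge> max R0 1" for r
      using R0[of r] that \<open>m \<ge> 1\<close> by (auto intro!: mult_left_mono)
    have "\<exists>S \<ge> max R0 1. \<forall>r \<ge> S. \<bar>f r\<bar> \<le> \<eta>"
      by (rule damped_solution_vanishes[where a = "\<lambda>r. m * h r", OF assms(2) f ode damping bounds \<open>m * c > 0\<close> _ \<open>\<eta> > 0\<close>]) auto
    then obtain S where S: "S \<ge> max R0 1" "\<And>r. r \<ge> S \<Longrightarrow> \<bar>f r\<bar> \<le> \<eta>" by blast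
    have "p * \<bar>f r\<bar> powr (p - 1) \<le> (m * c)\<^sup>2 / 4" if "r \<ge> S" for r
    proof -
      have "\<bar>f r\<bar> powr (p - 1) \<le> \<eta> powr (p - 1)"
        using S(2)[OF that] assms(2) by (intro powr_mono2) auto
      also have "\<dots> = (m * c)\<^sup>2 / (4 * p)"
        using assms(2) \<open>c > 0\<close> \<open>m \<ge> 1\<close> by (simp add: \<eta>_def powr_powr)
      finally show ?thesis using assms(2) by (simp add: field_simps)
    qed
    then show ?thesis
      using S(1) \<open>m * c > 0\<close> bounds(1) by (intro exI[of _ "m * c"] exI[of _ S]) auto
  next
    assume "Liminf at_top (\<lambda>r. ereal (\<psi>' r / \<psi> r)) = \<infinity> \<and>
      deriv (\<lambda>r. ln (\<psi>' r / \<psi> r)) \<in> O[at_top](\<lambda>_. 1) \<and>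
      (\<exists>r0 \<ge> 0. (\<forall>r \<ge> r0. \<psi>' r > 0) \<and> \<not> set_integrable lborel {r0<..} (\<lambda>r. \<psi> r / \<psi>' r))"
    then have blowup: "Liminf at_top (\<lambda>r. ereal (\<psi>' r / \<psi> r)) = \<infinity>" by blast
    define B where "B = ((p + 1) * energy p f f1 1) powr (1 / (p + 1))"
    have B: "\<bar>f r\<bar> \<le> B" if "r \<ge> 1" for r
      unfolding B_def using abs_le_of_energy_le[OF assms(2)]
        energy_decreasing[where a = "\<lambda>r. m * h r", OF assms(2) f ode damping, of 1 r] that by simp
    \<comment> \<open>This makes \<open>c\<^sup>2 / 4\<close> equal to \<open>p * B powr (p - 1)\<close>, the largest value that the potential can take.\<close>
    define c where "c = 2 * sqrt (p * B powr (p - 1))"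
    have "c \<ge> 0" using assms(2) by (simp add: c_def)
    have c2: "c\<^sup>2 / 4 = p * B powr (p - 1)" using assms(2) by (simp add: c_def power_mult_distrib)
    have "ereal c < Liminf at_top (\<lambda>r. ereal (\<psi>' r / \<psi> r))" by (simp add: blowup)
    from less_LiminfD[OF this] obtain R0 where R0: "\<And>r. r \<ge> R0 \<Longrightarrow> c < h r"
      unfolding eventually_at_top_linorder by (auto simp: h_def)
    have "c \<le> m * h r \<and> p * \<bar>f r\<bar> powr (p - 1) \<le> c\<^sup>2 / 4" if "r > max R0 1" for r
    proof
      have "c \<le> h r" "0 \<le> h r" using R0[of r] that \<open>c \<ge> 0\<close> by auto
      then show "c \<le> m * h r" using mult_right_mono[OF \<open>m \<ge> 1\<close>, of "h r"] by simp
      have "\<bar>f r\<bar> powr (p - 1) \<le> B powr (p - 1)"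
        using B[of r] that assms(2) by (intro powr_mono2) auto
      then show "p * \<bar>f r\<bar> powr (p - 1) \<le> c\<^sup>2 / 4" unfolding c2 using assms(2) by simp
    qed
    then show ?thesis
      using \<open>c \<ge> 0\<close> by (intro exI[of _ c] exI[of _ "max R0 1"]) auto
  qed
  then obtain c R where "c \<ge> 0" "R > 0"
    and far: "\<And>r. r > R \<Longrightarrow> c \<le> m * h r" "\<And>r. r > R \<Longrightarrow> p * \<bar>f r\<bar> powr (p - 1) \<le> c\<^sup>2 / 4"
    by blast
  have "stable_outside (model_metric \<psi>) p u (cball 0 R)"
  proof (rule stable_outside_cball[OF _ assms(2) u_cont \<psi> \<psi>' assms(6) \<open>c \<ge> 0\<close>])
    show "p * \<bar>u x\<bar> powr (p - 1) \<le> c\<^sup>2 / 4" if "norm x > R" for x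
      using far(2)[OF that] by (simp add: u_f)
  qed (use \<open>R > 0\<close> far(1) in \<open>auto simp: m_def h_def\<close>)
  then show ?thesis unfolding stable_outside_compact_def by (intro exI[of _ "cball 0 R"]) simp
qed

end
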